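(* Let $b > a \geq 1$ be integers with $\gcd(a,b)=1$ and $a+b$ odd. Then the limit \[ v(\mathrm{N}_{a,b}) = \lim_{h\to +\infty} \frac{2h}{3}\Bigg(\frac{1}{|\mathcal{B}_h|} \sum_{\mathbf{p}\in \mathcal{B}_h} \mathrm{N}_{a,b}(\mathbf{p})\Bigg)^{-1} \] exists and equals \[ v(\mathrm{N}_{a,b}) = \frac{2(a+b)b^2}{a^2+3b^2}. \] In particular, for the usual knight ($a=1,b=2$), $v(\mathrm{N}_{1,2})=24/13$.
   Context: For a finite set $A\subseteq\mathbb{Z}^2$ and $h\geq 1$, let $hA=\{\mathbf{a}_1+\cdots+\mathbf{a}_h : \mathbf{a}_1,\dots,\mathbf{a}_h\in A\}$ be the $h$-fold sumset. Define $A(0,0):=0$ and, for $(x,y)\neq(0,0)$, $A(x,y):=\min\{h\geq 1 : (x,y)\in hA\}$. For integers $a,b\geq 1$, the $(a,b)$-knight is $\mathrm{N}_{a,b}=\{(a,b),(b,a),(-a,b),(-b,a),(-b,-a),(-a,-b),(a,-b),(b,-a)\}$, and $\mathrm{N}_{a,b}(\mathbf{p})$ is the function $A(\mathbf{p})$ for $A=\mathrm{N}_{a,b}$ (finite for all $\mathbf{p}$ when $\gcd(a,b)=1$ and $a+b$ odd). For $h\geq 1$, $\mathcal{B}_h:=\{\mathbf{p}=(x,y)\in\mathbb{Z}^2 : \max\{|x|,|y|\}\leq h\}$. The quantity $v(A)$ defined by the displayed limit is called the average velocity of $A$. *)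

theory Defs
  imports Complex_Main "HOL-Library.Product_Plus"
begin

definition hfold_sumset :: "nat \<Rightarrow> (int \<times> int) set \<Rightarrow> (int \<times> int) set" where
  "hfold_sumset h A = {sum_list as | as. length as = h \<and> set as \<subseteq> A}"

(* The value A(p).  The minimum is meaningful only if p lies in some hA with h \<ge> 1;
   for any other p \<noteq> 0 (where A(p) would be infinite) the value is unspecified.  If A is an
   (a,b)-knight with gcd a b = 1 and a + b odd, there is no such p. *)
definition min_steps :: "(int \<times> int) set \<Rightarrow> int \<times> int \<Rightarrow> nat" where
  "min_steps A p = (if p = (0, 0) then 0 else (LEAST h. 1 \<le> h \<and> p \<in> hfold_sumset h A))"

definition knight :: "int \<Rightarrow> int \<Rightarrow> (int \<times> int) set" where
  "knight a b = {(a, b), (b, a), (-a, b), (-b, a), (-b, -a), (-a, -b), (a, -b), (b, -a)}"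

definition max_norm_ball :: "nat \<Rightarrow> (int \<times> int) set" where
  "max_norm_ball h = {(x, y). max \<bar>x\<bar> \<bar>y\<bar> \<le> int h}"

definition velocity_seq :: "(int \<times> int) set \<Rightarrow> nat \<Rightarrow> real" where
  "velocity_seq A h =
     2 * real h / 3 * inverse (1 / real (card (max_norm_ball h)) * (\<Sum>p\<in>max_norm_ball h. real (min_steps A p)))"

(* Meaningful only together with convergent (velocity_seq A). *)
definition average_velocity :: "(int \<times> int) set \<Rightarrow> real" where
  "average_velocity A = lim (velocity_seq A)"

end

theory Submission
  imports Defs "HOL-Real_Asymp.Real_Asymp"
begin

text \<open>
  The step count differs by a bounded amount from the norm whose unit ball is the octagon spanned
  by the knight moves. It is at least the norm because each move has norm at most 1. Conversely, a
  point in the cone over a side of the octagon is a nonnegative combination of two moves whose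
  coefficients sum to its norm; rounding them down leaves a remainder in a fixed box, whose points
  are reachable in boundedly many steps. The mean therefore grows like that of the norm, whose sum
  over a square is evaluated boundary layer by boundary layer.
\<close>

section \<open>Sumsets and step counts\<close>

lemma hfold_sumset_0: "hfold_sumset 0 A = {0}"
  by (auto simp: hfold_sumset_def)

lemma hfold_sumset_1: "p \<in> A \<Longrightarrow> p \<in> hfold_sumset 1 A"
  unfolding hfold_sumset_def by (auto intro!: exI[of _ "[p]"])

lemma hfold_sumset_add:
  assumes "p \<in> hfold_sumset m A" "q \<in> hfold_sumset n A"
  shows "p + q \<in> hfold_sumset (m + n) A"
proof -
  obtain xs ys where "p = sum_list xs" "length xs = m" "set xs \<subseteq> A"
    "q = sum_list ys" "length ys = n" "set ys \<subseteq> A"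
    using assms by (auto simp: hfold_sumset_def)
  then show ?thesis
    unfolding hfold_sumset_def by (auto intro!: exI[of _ "xs @ ys"])
qed

lemma hfold_sumset_multiple:
  "(u, v) \<in> A \<Longrightarrow> (int n * u, int n * v) \<in> hfold_sumset n A"
proof (induction n)
  case 0
  then show ?case by (simp add: hfold_sumset_0 zero_prod_def)
next
  case (Suc n)
  show ?case
    using hfold_sumset_add[OF hfold_sumset_1[OF Suc.prems] Suc.IH[OF Suc.prems]]
    by (simp add: algebra_simps)
qed

text \<open>An additive map can be applied summand by summand. It serves to transfer the symmetries
  of the set of knight moves to its sumsets.\<close>

lemma hfold_sumset_image:
  assumes "p \<in> hfold_sumset n A" "f ` A \<subseteq> A" "f 0 = 0" "\<And>p q. f (p + q) = f p + f q"
  shows "f p \<in> hfold_sumset n A"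
proof -
  obtain xs where xs: "p = sum_list xs" "length xs = n" "set xs \<subseteq> A"
    using assms(1) by (auto simp: hfold_sumset_def)
  have "f (sum_list xs) = sum_list (map f xs)"
    by (induction xs) (simp_all add: assms)
  moreover have "set (map f xs) \<subseteq> A"
    using assms(2) xs(3) by auto
  ultimately show ?thesis
    unfolding hfold_sumset_def using xs by (auto intro!: exI[of _ "map f xs"])
qed

text \<open>Subadditivity spreads \<open>F\<close> over the summands, each of which costs at most 1.
  Applied to a norm whose unit ball contains \<open>A\<close>, this is the lower bound for step
  counts.\<close>

lemma hfold_sumset_bound:
  fixes F :: "int \<times> int \<Rightarrow> real"
  assumes "p \<in> hfold_sumset n A" "F 0 \<le> 0" "\<And>p q. F (p + q) \<le> F p + F q"
    "\<And>p. p \<in> A \<Longrightarrow> F p \<le> 1"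
  shows "F p \<le> real n"
proof -
  obtain xs where xs: "p = sum_list xs" "length xs = n" "set xs \<subseteq> A"
    using assms(1) by (auto simp: hfold_sumset_def)
  have "set xs \<subseteq> A \<Longrightarrow> F (sum_list xs) \<le> real (length xs)"
  proof (induction xs)
    case Nil
    then show ?case using assms(2) by simp
  next
    case (Cons x xs)
    then show ?case using assms(3)[of x "sum_list xs"] assms(4)[of x] by simp
  qed
  with xs show ?thesis by simp
qed

text \<open>The special value 0 at the origin agrees with the 0-fold sumset \<open>{0}\<close>, and
  a nonzero point forces \<open>1 \<le> n\<close>. So \<open>min_steps\<close> acts as a minimum
  over all \<open>n \<ge> 0\<close>.\<close>

lemma min_steps_le:
  assumes "p \<in> hfold_sumset n A"
  shows "min_steps A p \<le> n"
proof (cases "p = (0, 0)")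
  case False
  then have "1 \<le> n"
    using assms by (cases n) (auto simp: hfold_sumset_0 zero_prod_def)
  then show ?thesis
    using assms False by (auto simp: min_steps_def intro: Least_le)
qed (simp add: min_steps_def)

lemma min_steps_mem:
  assumes "p \<in> hfold_sumset n A"
  shows "p \<in> hfold_sumset (min_steps A p) A"
proof (cases "p = (0, 0)")
  case False
  then have "1 \<le> n"
    using assms by (cases n) (auto simp: hfold_sumset_0 zero_prod_def)
  then have "1 \<le> n \<and> p \<in> hfold_sumset n A" using assms by simp
  from LeastI[of "\<lambda>h. 1 \<le> h \<and> p \<in> hfold_sumset h A", OF this] show ?thesis
    using False by (simp add: min_steps_def)
qed (simp add: min_steps_def hfold_sumset_0 zero_prod_def)

lemma max_norm_ball_eq: "max_norm_ball h = {- int h..int h} \<times> {- int h..int h}"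
  by (auto simp: max_norm_ball_def)

lemma finite_max_norm_ball: "finite (max_norm_ball h)"
  by (simp add: max_norm_ball_eq)

lemma card_max_norm_ball: "card (max_norm_ball h) = (2 * h + 1)\<^sup>2"
proof -
  have "nat (int h + 1 + int h) = 2 * h + 1" by simp
  then show ?thesis
    by (simp add: max_norm_ball_eq card_cartesian_product power2_eq_square add.assoc del: nat_add_distrib)
qed

section \<open>The step count of a knight\<close>

lemma knight_swap: "(x, y) \<in> hfold_sumset n (knight a b) \<Longrightarrow> (y, x) \<in> hfold_sumset n (knight a b)"
  using hfold_sumset_image[of "(x, y)" n "knight a b" "\<lambda>(x, y). (y, x)"]
  by (auto simp: knight_def zero_prod_def)

lemma knight_reflect: "(x, y) \<in> hfold_sumset n (knight a b) \<Longrightarrow> (-x, y) \<in> hfold_sumset n (knight a b)"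
  using hfold_sumset_image[of "(x, y)" n "knight a b" "\<lambda>(x, y). (-x, y)"]
  by (auto simp: knight_def zero_prod_def)

lemma knight_abs:
  assumes "(\<bar>x\<bar>, \<bar>y\<bar>) \<in> hfold_sumset n (knight a b)"
  shows "(x, y) \<in> hfold_sumset n (knight a b)"
proof -
  have *: "(x, v) \<in> hfold_sumset n (knight a b)"
    if "(\<bar>x\<bar>, v) \<in> hfold_sumset n (knight a b)" for x v
    using that knight_reflect[OF that] by (cases "x \<ge> 0") auto
  show ?thesis
    \<comment> \<open>Reflecting the second coordinate is reflecting the first one, conjugated by
      the swap.\<close>
    using *[OF assms] *[of y x] knight_swap by blast
qed

text \<open>The gauge of the convex hull of the knight moves, an octagon.\<close>

definition knight_norm :: "int \<Rightarrow> int \<Rightarrow> int \<times> int \<Rightarrow> real" where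
  "knight_norm a b = (\<lambda>(x, y).
     max (real_of_int (max \<bar>x\<bar> \<bar>y\<bar>) / real_of_int b)
         (real_of_int (\<bar>x\<bar> + \<bar>y\<bar>) / real_of_int (a + b)))"

locale knight_parameters =
  fixes a b :: int
  assumes a_pos: "1 \<le> a" and a_less_b: "a < b"
    and coprime: "gcd a b = 1" and odd_sum: "odd (a + b)"
begin

lemma knight_norm_triangle: "knight_norm a b (p + q) \<le> knight_norm a b p + knight_norm a b q"
proof -
  obtain x y where p: "p = (x, y)" by (cases p)
  obtain u v where q: "q = (u, v)" by (cases q)
  have pos: "0 \<le> real_of_int b" "0 \<le> real_of_int (a + b)"
    using a_pos a_less_b by auto
  have "max \<bar>x + u\<bar> \<bar>y + v\<bar> \<le> max \<bar>x\<bar> \<bar>y\<bar> + max \<bar>u\<bar> \<bar>v\<bar>"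
  proof (rule max.boundedI)
    show "\<bar>x + u\<bar> \<le> max \<bar>x\<bar> \<bar>y\<bar> + max \<bar>u\<bar> \<bar>v\<bar>"
      by (rule order_trans[OF abs_triangle_ineq add_mono[OF max.cobounded1 max.cobounded1]])
    show "\<bar>y + v\<bar> \<le> max \<bar>x\<bar> \<bar>y\<bar> + max \<bar>u\<bar> \<bar>v\<bar>"
      by (rule order_trans[OF abs_triangle_ineq add_mono[OF max.cobounded2 max.cobounded2]])
  qed
  then have "real_of_int (max \<bar>x + u\<bar> \<bar>y + v\<bar>) \<le>
      real_of_int (max \<bar>x\<bar> \<bar>y\<bar>) + real_of_int (max \<bar>u\<bar> \<bar>v\<bar>)"
    by (metis of_int_add of_int_le_iff)
  from divide_right_mono[OF this pos(1)]
  have 1: "real_of_int (max \<bar>x + u\<bar> \<bar>y + v\<bar>) / real_of_int b \<le>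
      real_of_int (max \<bar>x\<bar> \<bar>y\<bar>) / real_of_int b + real_of_int (max \<bar>u\<bar> \<bar>v\<bar>) / real_of_int b"
    by (simp only: add_divide_distrib)
  have "real_of_int (\<bar>x + u\<bar> + \<bar>y + v\<bar>) \<le> real_of_int (\<bar>x\<bar> + \<bar>y\<bar>) + real_of_int (\<bar>u\<bar> + \<bar>v\<bar>)"
    using add_mono[OF abs_triangle_ineq[of x u] abs_triangle_ineq[of y v]]
    by (metis add.assoc add.left_commute of_int_add of_int_le_iff)
  from divide_right_mono[OF this pos(2)]
  have 2: "real_of_int (\<bar>x + u\<bar> + \<bar>y + v\<bar>) / real_of_int (a + b) \<le>
      real_of_int (\<bar>x\<bar> + \<bar>y\<bar>) / real_of_int (a + b) + real_of_int (\<bar>u\<bar> + \<bar>v\<bar>) / real_of_int (a + b)"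
    by (simp only: add_divide_distrib)
  show ?thesis
    unfolding p q knight_norm_def add_Pair prod.case
    by (rule max.boundedI[OF order_trans[OF 1 add_mono[OF max.cobounded1 max.cobounded1]]
          order_trans[OF 2 add_mono[OF max.cobounded2 max.cobounded2]]])
qed

text \<open>The absolute values of a move's coordinates have maximum \<open>b\<close> and sum
  \<open>a + b\<close>, so both quotients equal 1: the moves are the vertices of the
  octagon.\<close>

lemma knight_norm_move: "p \<in> knight a b \<Longrightarrow> knight_norm a b p \<le> 1"
  using a_pos a_less_b by (auto simp: knight_def knight_norm_def)

text \<open>The reachable points are closed under addition and the symmetries. Coprimality yields
  \<open>(2, 0)\<close> by Bezout, and the odd sum then yields \<open>(1, 0)\<close>.\<close>

lemma knight_reaches: "\<exists>n. p \<in> hfold_sumset n (knight a b)"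
proof -
  define R where "R = {p. \<exists>n. p \<in> hfold_sumset n (knight a b)}"
  have add: "(x + u, y + v) \<in> R" if "(x, y) \<in> R" "(u, v) \<in> R" for x y u v
    using that hfold_sumset_add unfolding R_def by fastforce
  have swap: "(y, x) \<in> R" if "(x, y) \<in> R" for x y
    using that knight_swap unfolding R_def by blast
  have refl: "(-x, y) \<in> R" if "(x, y) \<in> R" for x y
    using that knight_reflect unfolding R_def by blast
  have zero: "(0, 0) \<in> R"
    unfolding R_def using hfold_sumset_0[of "knight a b"] by (auto simp: zero_prod_def)
  have ab: "(a, b) \<in> R" "(a, -b) \<in> R" "(b, a) \<in> R" "(b, -a) \<in> R"
    unfolding R_def by (auto intro!: exI[of _ 1] hfold_sumset_1 simp: knight_def simp del: One_nat_def)
  have nmult: "(int n * x, 0) \<in> R" if "(x, 0) \<in> R" for n x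
  proof (induction n)
    case (Suc n)
    then show ?case using add[OF that Suc] by (simp add: algebra_simps)
  qed (simp add: zero)
  have mult: "(k * x, 0) \<in> R" if "(x, 0) \<in> R" for k x
    using nmult[OF that, of "nat \<bar>k\<bar>"] refl[OF nmult[OF that, of "nat \<bar>k\<bar>"]]
    by (cases "k \<ge> 0") auto
  \<comment> \<open>A move plus its mirror image in the first axis has second coordinate 0.\<close>
  have ab2: "(2 * a, 0) \<in> R" "(2 * b, 0) \<in> R"
    using add[OF ab(1,2)] add[OF ab(3,4)] by simp_all
  obtain s t where st: "s * a + t * b = 1"
    using bezout_int[of a b] coprime by auto
  have "(s * (2 * a) + t * (2 * b), 0 + 0) \<in> R"
    by (rule add[OF mult[OF ab2(1)] mult[OF ab2(2)]])
  moreover have "s * (2 * a) + t * (2 * b) = 2"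
    using st by algebra
  ultimately have "(2, 0) \<in> R" by simp
  then have two: "(k * 2, 0) \<in> R" "(0, k * 2) \<in> R" for k
    using mult swap by blast+
  \<comment> \<open>Subtracting reachable vectors with even coordinates leaves only the parities,
    here \<open>(1, 0)\<close>.\<close>
  have one_aux: "(1, 0) \<in> R" if u: "odd u" and v: "even v" and uv: "(u, v) \<in> R" for u v
  proof -
    obtain k l where "u = 2 * k + 1" "v = 2 * l"
      using u v by (metis oddE evenE)
    then show ?thesis
      using add[OF add[OF uv two(1)[of "-k"]] two(2)[of "-l"]] by simp
  qed
  \<comment> \<open>Exactly one of \<open>a\<close> and \<open>b\<close> is odd; put it first by
    choosing \<open>(a, b)\<close> or \<open>(b, a)\<close>.\<close>
  have one: "(1, 0) \<in> R"
    using one_aux[of a b] one_aux[of b a] ab odd_sum by auto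
  obtain x y where p: "p = (x, y)" by (cases p)
  have "(x, y) \<in> R"
    using add[OF mult[OF one, of x] swap[OF mult[OF one, of y]]] by simp
  then show ?thesis unfolding p R_def by blast
qed

lemma knight_norm_le_min_steps: "knight_norm a b p \<le> real (min_steps (knight a b) p)"
proof -
  obtain n where "p \<in> hfold_sumset n (knight a b)" using knight_reaches by blast
  from min_steps_mem[OF this] show ?thesis
    by (rule hfold_sumset_bound)
       (use knight_norm_triangle knight_norm_move in \<open>auto simp: knight_norm_def zero_prod_def\<close>)
qed

text \<open>Make \<open>\<lfloor>s\<rfloor>\<close> and \<open>\<lfloor>t\<rfloor>\<close> copies of
  the two moves. Each coordinate of what remains combines entries of size at most \<open>b\<close>
  with two fractional parts, so it is at most \<open>2 * b\<close> in absolute value, and at most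
  \<open>C\<close> further steps cover it.\<close>

lemma min_steps_cone:
  fixes s t :: real
  assumes uv: "(u1, u2) \<in> knight a b" "(v1, v2) \<in> knight a b" and st: "0 \<le> s" "0 \<le> t"
    and xy: "real_of_int x = s * u1 + t * v1" "real_of_int y = s * u2 + t * v2"
    and C: "\<And>q. q \<in> max_norm_ball (nat (2 * b)) \<Longrightarrow> min_steps (knight a b) q \<le> C"
  shows "\<exists>n. (x, y) \<in> hfold_sumset n (knight a b) \<and> real n \<le> s + t + real C"
proof -
  define m n where "m = nat \<lfloor>s\<rfloor>" and "n = nat \<lfloor>t\<rfloor>"
  have m: "real m \<le> s" "s - real m \<le> 1" and n: "real n \<le> t" "t - real n \<le> 1"
    using st unfolding m_def n_def by linarith+
  define q where "q = (x - (int m * u1 + int n * v1), y - (int m * u2 + int n * v2))"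
  have bd: "\<bar>z - (int m * u + int n * v)\<bar> \<le> 2 * b"
    if "real_of_int z = s * u + t * v" "\<bar>u\<bar> \<le> b" "\<bar>v\<bar> \<le> b" for z u v
  proof -
    have "\<bar>(s - real m) * u\<bar> \<le> 1 * real_of_int b" "\<bar>(t - real n) * v\<bar> \<le> 1 * real_of_int b"
      unfolding abs_mult using m n that by (intro mult_mono; simp)+
    then have "\<bar>(s - real m) * u + (t - real n) * v\<bar> \<le> real_of_int (2 * b)"
      using abs_triangle_ineq[of "(s - real m) * u" "(t - real n) * v"] by simp
    moreover have "(s - real m) * u + (t - real n) * v = real_of_int (z - (int m * u + int n * v))"
      using that by (simp add: algebra_simps)
    ultimately show ?thesis by (simp only: of_int_abs[symmetric] of_int_le_iff)
  qed
  have "\<bar>w1\<bar> \<le> b \<and> \<bar>w2\<bar> \<le> b" if "(w1, w2) \<in> knight a b" for w1 w2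
    using that a_pos a_less_b by (auto simp: knight_def)
  with uv have "\<bar>u1\<bar> \<le> b" "\<bar>u2\<bar> \<le> b" "\<bar>v1\<bar> \<le> b" "\<bar>v2\<bar> \<le> b"
    by blast+
  then have "\<bar>fst q\<bar> \<le> 2 * b" "\<bar>snd q\<bar> \<le> 2 * b"
    unfolding q_def fst_conv snd_conv using bd xy by blast+
  then have "q \<in> max_norm_ball (nat (2 * b))"
    using a_pos a_less_b by (cases q) (simp add: max_norm_ball_def)
  then have qC: "min_steps (knight a b) q \<le> C" by (rule C)
  obtain k where "q \<in> hfold_sumset k (knight a b)" using knight_reaches by blast
  then have "q \<in> hfold_sumset (min_steps (knight a b) q) (knight a b)" by (rule min_steps_mem)
  from hfold_sumset_add[OF this hfold_sumset_add[OF
      hfold_sumset_multiple[OF uv(1), of m] hfold_sumset_multiple[OF uv(2), of n]]]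
  have "(x, y) \<in> hfold_sumset (min_steps (knight a b) q + (m + n)) (knight a b)"
    by (simp add: q_def)
  then show ?thesis
    using qC m n by (intro exI[of _ "min_steps (knight a b) q + (m + n)"]) auto
qed

text \<open>By symmetry it suffices to treat \<open>0 \<le> y \<le> x\<close>. This octant is
  covered by the cones over two sides of the octagon, the vertical one from \<open>(b, -a)\<close>
  to \<open>(b, a)\<close> and the slanted one from \<open>(b, a)\<close> to \<open>(a, b)\<close>;
  the ray through \<open>(b, a)\<close> separates them.\<close>

lemma min_steps_upper: "\<exists>C::nat. \<forall>p. real (min_steps (knight a b) p) \<le> knight_norm a b p + real C"
proof -
  define C where "C = Max (min_steps (knight a b) ` max_norm_ball (nat (2 * b)))"
  have C: "min_steps (knight a b) q \<le> C" if "q \<in> max_norm_ball (nat (2 * b))" for q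
    unfolding C_def using that finite_max_norm_ball by (intro Max_ge) auto
  define A B where "A = real_of_int a" and "B = real_of_int b"
  have AB: "0 < A" "A < B" using a_pos a_less_b by (simp_all add: A_def B_def)
  have octant: "\<exists>n. (x, y) \<in> hfold_sumset n (knight a b) \<and> real n \<le> knight_norm a b (x, y) + real C"
    if xy: "0 \<le> y" "y \<le> x" for x y
  proof -
    define X Y where "X = real_of_int x" and "Y = real_of_int y"
    have XY: "0 \<le> Y" "Y \<le> X" using xy by (simp_all add: X_def Y_def)
    \<comment> \<open>The norm dominates both quotients; the cone decides which of them equals
      \<open>s + t\<close>.\<close>
    have norm: "X / B \<le> knight_norm a b (x, y)" "(X + Y) / (A + B) \<le> knight_norm a b (x, y)"
      using xy by (auto simp: knight_norm_def X_def Y_def A_def B_def max_def)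
    show ?thesis
    proof (cases "B * Y \<le> A * X")
      case True
      \<comment> \<open>Below the ray through \<open>(b, a)\<close>: these solve
        \<open>X = (s + t) * B\<close> and \<open>Y = (s - t) * A\<close>, and the case condition is
        \<open>t \<ge> 0\<close>.\<close>
      define s t where "s = (A * X + B * Y) / (2 * A * B)" and "t = (A * X - B * Y) / (2 * A * B)"
      have "\<exists>n. (x, y) \<in> hfold_sumset n (knight a b) \<and> real n \<le> s + t + real C"
      proof (rule min_steps_cone)
        show "(b, a) \<in> knight a b" "(b, - a) \<in> knight a b" by (simp_all add: knight_def)
        show "0 \<le> s" "0 \<le> t" using AB XY True by (auto simp: s_def t_def)
        show "real_of_int x = s * real_of_int b + t * real_of_int b"
          "real_of_int y = s * real_of_int a + t * real_of_int (- a)"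
          using AB unfolding s_def t_def of_int_minus A_def[symmetric] B_def[symmetric]
            X_def[symmetric] Y_def[symmetric] by (auto simp: field_simps)
      qed (rule C)
      moreover have "s + t = X / B"
        using AB by (simp add: s_def t_def field_simps)
      ultimately show ?thesis using norm(1) by force
    next
      case False
      \<comment> \<open>Above the ray: Cramer's rule for the moves \<open>(b, a)\<close> and
        \<open>(a, b)\<close>, whose determinant is \<open>D\<close>. Its factor
        \<open>B - A\<close> cancels in \<open>s + t\<close>.\<close>
      define D where "D = B\<^sup>2 - A\<^sup>2"
      have D: "D > 0" using AB by (simp add: D_def power_strict_mono)
      have D': "D = (B - A) * (B + A)" by (simp add: D_def algebra_simps power2_eq_square)
      define s t where "s = (B * X - A * Y) / D" and "t = (B * Y - A * X) / D"
      have "\<exists>n. (x, y) \<in> hfold_sumset n (knight a b) \<and> real n \<le> s + t + real C"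
      proof (rule min_steps_cone)
        show "(b, a) \<in> knight a b" "(a, b) \<in> knight a b" by (simp_all add: knight_def)
        have "A * Y \<le> B * X" using AB XY by (intro mult_mono) auto
        then show "0 \<le> s" "0 \<le> t" using D False by (auto simp: s_def t_def)
        show "real_of_int x = s * real_of_int b + t * real_of_int a"
          "real_of_int y = s * real_of_int a + t * real_of_int b"
          using D unfolding s_def t_def A_def[symmetric] B_def[symmetric]
            X_def[symmetric] Y_def[symmetric]
          by (simp_all add: divide_simps) (simp_all add: D_def algebra_simps power2_eq_square)
      qed (rule C)
      moreover have "s + t = (X + Y) / (A + B)"
      proof -
        have "s + t = ((B - A) * (X + Y)) / ((B - A) * (B + A))"
          unfolding s_def t_def D' by (simp add: add_divide_distrib[symmetric] algebra_simps)
        then show ?thesis using AB by (simp add: add.commute)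
      qed
      ultimately show ?thesis using norm(2) by force
    qed
  qed
  have "real (min_steps (knight a b) p) \<le> knight_norm a b p + real C" for p
  proof -
    obtain x y where p: "p = (x, y)" by (cases p)
    have "\<exists>n. (\<bar>x\<bar>, \<bar>y\<bar>) \<in> hfold_sumset n (knight a b) \<and> real n \<le> knight_norm a b (x, y) + real C"
    proof (cases "\<bar>y\<bar> \<le> \<bar>x\<bar>")
      case True
      then show ?thesis using octant[of "\<bar>y\<bar>" "\<bar>x\<bar>"] by (simp add: knight_norm_def)
    next
      case False
      then obtain n where "(\<bar>y\<bar>, \<bar>x\<bar>) \<in> hfold_sumset n (knight a b)"
        "real n \<le> knight_norm a b (\<bar>y\<bar>, \<bar>x\<bar>) + real C"
        using octant[of "\<bar>x\<bar>" "\<bar>y\<bar>"] by auto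
      then show ?thesis
        using knight_swap[of "\<bar>y\<bar>" "\<bar>x\<bar>" n a b]
        by (auto simp: knight_norm_def max.commute add.commute)
    qed
    then obtain n where n: "(x, y) \<in> hfold_sumset n (knight a b)"
      "real n \<le> knight_norm a b (x, y) + real C"
      using knight_abs by blast
    then show ?thesis using min_steps_le[OF n(1)] p by simp
  qed
  then show ?thesis by blast
qed

end

section \<open>Summation over squares\<close>

lemma sum_symmetric_Suc:
  fixes g :: "int \<Rightarrow> real"
  shows "sum g {- int (Suc n)..int (Suc n)} = sum g {- int n..int n} + g (int (Suc n)) + g (- int (Suc n))"
proof -
  have "{- int (Suc n)..int (Suc n)} = insert (int (Suc n)) (insert (- int (Suc n)) {- int n..int n})"
    by auto
  then show ?thesis by simp
qed

lemma sum_symmetric_even: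
  fixes g :: "int \<Rightarrow> real"
  assumes "\<And>x. g (- x) = g x"
  shows "sum g {- int n..int n} = g 0 + 2 * (\<Sum>k=1..n. g (int k))"
proof (induction n)
  case (Suc n)
  then show ?case unfolding sum_symmetric_Suc using assms[of "int (Suc n)"] by simp
qed simp

text \<open>The new boundary layer splits into eight equivalent half-sides. Summing each over
  \<open>k = 1..Suc h\<close> counts the four corners twice and misses the four points on the axes,
  which explains the two corrections.\<close>

lemma sum_max_norm_ball_Suc:
  fixes f :: "int \<times> int \<Rightarrow> real"
  assumes swap: "\<And>x y. f (y, x) = f (x, y)" and refl: "\<And>x y. f (- x, y) = f (x, y)"
  shows "sum f (max_norm_ball (Suc h)) = sum f (max_norm_ball h) +
    8 * (\<Sum>k=1..Suc h. f (int (Suc h), int k)) + 4 * f (int (Suc h), 0)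
    - 4 * f (int (Suc h), int (Suc h))"
proof -
  have refl': "f (x, - y) = f (x, y)" for x y
    using swap refl by metis
  define N where "N = int (Suc h)"
  have "sum f (max_norm_ball (Suc h)) = (\<Sum>x=-N..N. \<Sum>y=-N..N. f (x, y))"
    by (simp add: max_norm_ball_eq sum.cartesian_product N_def)
  also have "\<dots> = (\<Sum>x=- int h..int h. \<Sum>y=-N..N. f (x, y)) + 2 * (\<Sum>y=-N..N. f (N, y))"
    unfolding N_def
    by (subst sum_symmetric_Suc[of "\<lambda>x. \<Sum>y=- int (Suc h)..int (Suc h). f (x, y)"]) (simp only: refl)
  \<comment> \<open>The two full columns already contain the corners, so the rows
    \<open>y = N\<close> and \<open>y = -N\<close> contribute only over \<open>-h..h\<close>; the
    swap turns them into column values.\<close>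
  also have "(\<Sum>x=- int h..int h. \<Sum>y=-N..N. f (x, y)) =
      (\<Sum>x=- int h..int h. (\<Sum>y=- int h..int h. f (x, y)) + 2 * f (N, x))"
    unfolding N_def by (subst sum_symmetric_Suc) (simp only: refl' swap[of _ "int (Suc h)"] add.assoc mult_2)
  also have "\<dots> = sum f (max_norm_ball h) + 2 * (\<Sum>x=- int h..int h. f (N, x))"
    by (simp add: max_norm_ball_eq sum.cartesian_product sum.distrib sum_distrib_left)
  also have "(\<Sum>x=- int h..int h. f (N, x)) = f (N, 0) + 2 * (\<Sum>k=1..h. f (N, int k))"
    by (rule sum_symmetric_even) (rule refl')
  also have "(\<Sum>y=-N..N. f (N, y)) = f (N, 0) + 2 * (\<Sum>k=1..Suc h. f (N, int k))"
    unfolding N_def by (rule sum_symmetric_even) (rule refl')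
  finally show ?thesis by (simp add: N_def)
qed

text \<open>The hinge function \<^term>\<open>\<lambda>t. max 0 (B * t - c)\<close> is increasing with antiderivative
  \<^term>\<open>\<lambda>t. (max 0 (B * t - c))\<^sup>2 / (2 * B)\<close>, so its sum telescopes against the latter.\<close>

lemma hinge_sum_bounds:
  fixes B c :: real
  assumes "0 < B" "0 \<le> c"
  shows "(max 0 (B * n - c))\<^sup>2 / (2 * B) \<le> (\<Sum>k=1..n. max 0 (B * real k - c))"
    and "(\<Sum>k=1..n. max 0 (B * real k - c)) \<le> (max 0 (B * n - c))\<^sup>2 / (2 * B) + max 0 (B * n - c)"
proof -
  define g where "g t = max 0 (B * t - c)" for t :: real
  have step: "2 * B * g t \<le> (g (t + 1))\<^sup>2 - (g t)\<^sup>2 \<and> (g (t + 1))\<^sup>2 - (g t)\<^sup>2 \<le> 2 * B * g (t + 1)" for t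
  proof -
    define u where "u = B * t - c"
    have g: "g t = max 0 u" "g (t + 1) = max 0 (u + B)"
      by (simp_all add: g_def u_def algebra_simps)
    \<comment> \<open>The kink of the hinge lies at or left of \<open>t\<close>, between
      \<open>t\<close> and \<open>t + 1\<close>, or right of \<open>t + 1\<close>.\<close>
    consider "u \<ge> 0" | "u < 0" "u + B \<ge> 0" | "u + B < 0" by linarith
    then show ?thesis
    proof cases
      case 1
      then have "g t = u" "g (t + 1) = u + B"
        unfolding g using assms(1) by simp_all
      moreover have "(u + B)\<^sup>2 - u\<^sup>2 = 2 * B * u + B\<^sup>2" "2 * B * (u + B) = 2 * B * u + B\<^sup>2 + B\<^sup>2"
        by algebra+
      ultimately show ?thesis by simp
    next
      case 2
      then have "g t = 0" "g (t + 1) = u + B"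
        unfolding g by simp_all
      moreover have "(u + B) * (u + B) \<le> 2 * B * (u + B)"
        using 2 assms(1) by (intro mult_right_mono) auto
      ultimately show ?thesis by (simp add: power2_eq_square)
    next
      case 3
      then have "g t = 0" "g (t + 1) = 0"
        unfolding g using assms(1) by simp_all
      then show ?thesis by simp
    qed
  qed
  \<comment> \<open>Since \<open>c \<ge> 0\<close>, the hinge vanishes at 0 and the telescoping sum
    of squares has no initial term.\<close>
  have g0: "g 0 = 0" using assms by (simp add: g_def)
  define G where "G n = (\<Sum>k=1..n. g (real k))" for n :: nat
  have "(g n)\<^sup>2 \<le> 2 * B * G n \<and> 2 * B * G n \<le> (g n)\<^sup>2 + 2 * B * g n"
  proof (induction n)
    case 0
    show ?case by (simp add: g0 G_def)
  next
    case (Suc n)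
    have G: "2 * B * G (Suc n) = 2 * B * G n + 2 * B * g (real n + 1)"
      by (simp add: G_def distrib_left add.commute)
    have Suc_eq: "real (Suc n) = real n + 1" by simp
    have "(g (real n + 1))\<^sup>2 \<le> 2 * B * G n + 2 * B * g (real n + 1)"
      using Suc.IH[THEN conjunct1] step[of "real n", THEN conjunct2] by linarith
    moreover have "2 * B * G n + 2 * B * g (real n + 1) \<le> (g (real n + 1))\<^sup>2 + 2 * B * g (real n + 1)"
      using Suc.IH[THEN conjunct2] step[of "real n", THEN conjunct1] by linarith
    ultimately show ?case unfolding G Suc_eq ..
  qed
  then have "(g n)\<^sup>2 / (2 * B) \<le> G n" "G n \<le> (g n)\<^sup>2 / (2 * B) + g n"
    using assms(1) by (simp_all add: field_simps)
  then show "(max 0 (B * n - c))\<^sup>2 / (2 * B) \<le> (\<Sum>k=1..n. max 0 (B * real k - c))"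
    "(\<Sum>k=1..n. max 0 (B * real k - c)) \<le> (max 0 (B * n - c))\<^sup>2 / (2 * B) + max 0 (B * n - c)"
    unfolding G_def g_def .
qed

text \<open>The increment of \<open>c * n ^ 3\<close> from \<open>m\<close> to \<open>m + 1\<close>
  is \<open>3 * c * (m + 1)^2 - c * (3 * m + 2)\<close>. Hence each step adds only a linear error,
  and these errors accumulate to a quadratic one; with the factor \<open>3 * c + K\<close> the
  induction closes.\<close>

lemma cubic_growth:
  fixes S :: "nat \<Rightarrow> real"
  assumes "S 0 = 0" "0 \<le> c" "0 \<le> K"
    and step: "\<And>n. \<bar>S (Suc n) - S n - 3 * c * (real (Suc n))\<^sup>2\<bar> \<le> K * real (Suc n)"
  shows "\<bar>S n - c * real n ^ 3\<bar> \<le> (3 * c + K) * (real n)\<^sup>2"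
proof (induction n)
  case (Suc n)
  define m where "m = real n"
  have m: "0 \<le> m" "real (Suc n) = m + 1" by (simp_all add: m_def)
  define d e where "d = S n - c * m ^ 3" and "e = S (Suc n) - S n - 3 * c * (m + 1)\<^sup>2"
  have d: "\<bar>d\<bar> \<le> (3 * c + K) * m\<^sup>2" and e: "\<bar>e\<bar> \<le> K * (m + 1)"
    using Suc.IH step[of n] unfolding d_def e_def m_def[symmetric] m(2) by simp_all
  have "S (Suc n) - c * (m + 1) ^ 3 = d + e + c * (3 * m + 2)"
    by (simp add: d_def e_def power2_eq_square power3_eq_cube algebra_simps)
  moreover have "\<bar>d + e + c * (3 * m + 2)\<bar> \<le> \<bar>d\<bar> + \<bar>e\<bar> + c * (3 * m + 2)"
  proof -
    have "\<bar>c * (3 * m + 2)\<bar> = c * (3 * m + 2)" using m assms(2) by simp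
    then show ?thesis
      by (metis abs_triangle_ineq add_right_mono order_trans)
  qed
  ultimately have "\<bar>S (Suc n) - c * (m + 1) ^ 3\<bar> \<le> \<bar>d\<bar> + \<bar>e\<bar> + c * (3 * m + 2)"
    by (simp only:)
  also have "\<dots> \<le> (3 * c + K) * m\<^sup>2 + K * (m + 1) + c * (3 * m + 2)"
    by (intro add_mono d e order_refl)
  also have "\<dots> \<le> (3 * c + K) * (m + 1)\<^sup>2"
  proof -
    have "0 \<le> 3 * (c * m) + K * m + c" using m assms by simp
    moreover have "(3 * c + K) * (m + 1)\<^sup>2 - ((3 * c + K) * m\<^sup>2 + K * (m + 1) + c * (3 * m + 2)) =
        3 * (c * m) + K * m + c"
      by algebra
    ultimately show ?thesis by linarith
  qed
  finally show ?case by (simp only: m(2))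
qed (simp add: assms)

section \<open>The limit\<close>

context knight_parameters
begin

text \<open>Each layer at distance \<open>n\<close> contributes \<open>3 * L * n^2\<close> up to a
  linear error, so \<open>cubic_growth\<close> applies.\<close>

lemma knight_norm_sum_max_norm_ball:
  defines "L \<equiv> 4 * ((real_of_int a)\<^sup>2 + 3 * (real_of_int b)\<^sup>2) /
    (3 * (real_of_int b)\<^sup>2 * (real_of_int a + real_of_int b))"
  shows "\<exists>K. \<forall>h. \<bar>sum (knight_norm a b) (max_norm_ball h) - L * real h ^ 3\<bar> \<le> K * (real h)\<^sup>2"
proof -
  define A B where "A = real_of_int a" and "B = real_of_int b"
  have AB: "0 < A" "A < B" using a_pos a_less_b by (simp_all add: A_def B_def)
  define S where "S h = sum (knight_norm a b) (max_norm_ball h)" for h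
  \<comment> \<open>The three terms bound the error of the hinge sums, the axis points and the
    corners.\<close>
  define K where "K = 8 * (B - A) / (B * (A + B)) + 4 / B + 8 / (A + B)"
  have K: "0 \<le> K" using AB by (simp add: K_def)
  have L: "0 \<le> L" using AB by (simp add: L_def A_def[symmetric] B_def[symmetric])
  \<comment> \<open>Along a half-side the norm is constant up to the ray through
    \<open>(b, a)\<close>, at \<open>k = A * n / B\<close>, and then grows linearly: a constant plus
    a scaled hinge.\<close>
  have side: "knight_norm a b (int n, int k) = real n / B + max 0 (B * real k - A * real n) / (B * (A + B))"
    if "k \<le> n" for n k
  proof -
    have "knight_norm a b (int n, int k) = max (real n / B) ((real n + real k) / (A + B))"
      using that by (simp add: knight_norm_def A_def B_def)
    also have "(real n + real k) / (A + B) = real n / B + (B * real k - A * real n) / (B * (A + B))"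
      using AB by (simp add: divide_simps) (simp add: algebra_simps)
    finally show ?thesis using AB by (auto simp: max_def divide_simps)
  qed
  have "\<bar>S (Suc h) - S h - 3 * L * (real (Suc h))\<^sup>2\<bar> \<le> K * real (Suc h)" for h
  proof -
    define n where "n = Suc h"
    define m where "m = real n"
    define H where "H = (\<Sum>k=1..n. max 0 (B * real k - A * m))"
    have m: "0 \<le> m" by (simp add: m_def)
    have max: "max 0 (B * m - A * m) = (B - A) * m"
      unfolding left_diff_distrib[symmetric] using AB m by (intro max_absorb2) simp
    have H: "((B - A) * m)\<^sup>2 / (2 * B) \<le> H" "H \<le> ((B - A) * m)\<^sup>2 / (2 * B) + (B - A) * m"
      using hinge_sum_bounds[of B "A * m" n] AB m unfolding H_def m_def[symmetric] max by auto
    define E where "E = H - ((B - A) * m)\<^sup>2 / (2 * B)"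
    have E: "0 \<le> E" "E \<le> (B - A) * m" using H by (simp_all add: E_def)
    have "(\<Sum>k=1..n. knight_norm a b (int n, int k)) =
        (\<Sum>k=1..n. m / B + max 0 (B * real k - A * m) / (B * (A + B)))"
      by (intro sum.cong refl) (simp add: side m_def)
    also have "\<dots> = m * (m / B) + H / (B * (A + B))"
      by (simp add: sum.distrib sum_divide_distrib H_def m_def)
    finally have sum: "(\<Sum>k=1..n. knight_norm a b (int n, int k)) = m * (m / B) + H / (B * (A + B))" .
    have "S n = S h + 8 * (\<Sum>k=1..n. knight_norm a b (int n, int k))
        + 4 * knight_norm a b (int n, 0) - 4 * knight_norm a b (int n, int n)"
      unfolding S_def n_def
      by (rule sum_max_norm_ball_Suc) (simp_all add: knight_norm_def max.commute add.commute)
    moreover have "knight_norm a b (int n, 0) = m / B"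
      using side[of 0 n] AB m by (simp add: m_def)
    moreover have "knight_norm a b (int n, int n) = 2 * m / (A + B)"
    proof -
      have "knight_norm a b (int n, int n) = max (m / B) (2 * m / (A + B))"
        by (simp add: knight_norm_def A_def B_def m_def)
      also have "m / B \<le> 2 * m / (A + B)"
      proof -
        have "m * (A + B) \<le> m * (2 * B)" using AB m by (intro mult_left_mono) auto
        then show ?thesis using AB by (simp add: field_simps)
      qed
      then have "max (m / B) (2 * m / (A + B)) = 2 * m / (A + B)" by simp
      finally show ?thesis .
    qed
    ultimately have "S n - S h = 8 * (m * (m / B) + H / (B * (A + B))) + 4 * m / B - 8 * m / (A + B)"
      using sum by simp
    \<comment> \<open>The numerator \<open>a^2 + 3 * b^2\<close> arises here, from
      \<open>8 * B * (A + B) + 4 * (B - A)^2 = 4 * (A^2 + 3 * B^2)\<close>.\<close>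
    moreover have "3 * L * m\<^sup>2 = 8 * (m * (m / B) + (((B - A) * m)\<^sup>2 / (2 * B)) / (B * (A + B)))"
      using AB unfolding L_def A_def[symmetric] B_def[symmetric]
      by (simp add: divide_simps) (simp add: power2_eq_square algebra_simps)
    ultimately have "S n - S h - 3 * L * m\<^sup>2 = 8 * E / (B * (A + B)) + 4 * m / B - 8 * m / (A + B)"
      by (simp add: E_def diff_divide_distrib)
    moreover have "0 \<le> 8 * E / (B * (A + B))" using E AB by simp
    moreover have "8 * E / (B * (A + B)) \<le> 8 * ((B - A) * m) / (B * (A + B))"
      using E AB by (intro divide_right_mono) auto
    moreover have "0 \<le> 4 * m / B" "0 \<le> 8 * m / (A + B)" using AB m by simp_all
    moreover have "K * m = 8 * ((B - A) * m) / (B * (A + B)) + 4 * m / B + 8 * m / (A + B)"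
      by (simp add: K_def algebra_simps)
    ultimately have "\<bar>S n - S h - 3 * L * m\<^sup>2\<bar> \<le> K * m"
      by linarith
    then show ?thesis by (simp add: n_def m_def)
  qed
  moreover have "S 0 = 0"
    by (simp add: S_def max_norm_ball_eq knight_norm_def)
  ultimately have "\<bar>S h - L * real h ^ 3\<bar> \<le> (3 * L + K) * (real h)\<^sup>2" for h
    using L K by (intro cubic_growth)
  then show ?thesis unfolding S_def by (intro exI allI)
qed

text \<open>The sequence is \<open>2 * h / 3\<close> times \<open>(2 * h + 1)^2 / T h\<close>, and
  \<open>T h\<close> grows like \<open>L * h ^ 3\<close>, so the limit is
  \<open>8 / (3 * L)\<close>.\<close>

lemma velocity_seq_tendsto:
  "velocity_seq (knight a b) \<longlonglongrightarrow>
     2 * (real_of_int a + real_of_int b) * (real_of_int b)\<^sup>2 /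
       ((real_of_int a)\<^sup>2 + 3 * (real_of_int b)\<^sup>2)"
proof -
  define A B where "A = real_of_int a" and "B = real_of_int b"
  have AB: "0 < A" "0 < B" using a_pos a_less_b by (simp_all add: A_def B_def)
  define L where "L = 4 * (A\<^sup>2 + 3 * B\<^sup>2) / (3 * B\<^sup>2 * (A + B))"
  have pos: "0 < A\<^sup>2 + 3 * B\<^sup>2" using AB by (simp add: add_pos_pos)
  have L: "L > 0" using AB pos by (simp add: L_def)
  define T where "T h = (\<Sum>p\<in>max_norm_ball h. real (min_steps (knight a b) p))" for h
  define S where "S h = sum (knight_norm a b) (max_norm_ball h)" for h
  obtain K where K: "\<bar>S h - L * real h ^ 3\<bar> \<le> K * (real h)\<^sup>2" for h
    using knight_norm_sum_max_norm_ball unfolding S_def L_def A_def B_def by blast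
  obtain C :: nat where C: "real (min_steps (knight a b) p) \<le> knight_norm a b p + real C" for p
    using min_steps_upper by blast
  have ST: "S h \<le> T h" for h
    unfolding S_def T_def by (intro sum_mono knight_norm_le_min_steps)
  \<comment> \<open>A bounded error at each of \<open>(2 * h + 1)^2\<close> points is quadratic in
    total and vanishes against \<open>h ^ 3\<close>.\<close>
  have TS: "T h \<le> S h + real C * (2 * real h + 1)\<^sup>2" for h
  proof -
    have "T h \<le> (\<Sum>p\<in>max_norm_ball h. knight_norm a b p + real C)"
      unfolding T_def by (intro sum_mono C)
    then show ?thesis
      by (simp add: sum.distrib S_def card_max_norm_ball algebra_simps)
  qed
  have "(\<lambda>h. T h / real h ^ 3) \<longlonglongrightarrow> L"
  proof (rule tendsto_sandwich)
    show "(\<lambda>h. (L * real h ^ 3 - K * (real h)\<^sup>2) / real h ^ 3) \<longlonglongrightarrow> L"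
      by real_asymp
    show "(\<lambda>h. (L * real h ^ 3 + K * (real h)\<^sup>2 + real C * (2 * real h + 1)\<^sup>2) / real h ^ 3) \<longlonglongrightarrow> L"
      by real_asymp
    show "\<forall>\<^sub>F h in sequentially. (L * real h ^ 3 - K * (real h)\<^sup>2) / real h ^ 3 \<le> T h / real h ^ 3"
    proof (intro always_eventually allI divide_right_mono)
      show "L * real h ^ 3 - K * (real h)\<^sup>2 \<le> T h" for h
        using K[of h] ST[of h] by linarith
    qed simp
    show "\<forall>\<^sub>F h in sequentially. T h / real h ^ 3 \<le>
        (L * real h ^ 3 + K * (real h)\<^sup>2 + real C * (2 * real h + 1)\<^sup>2) / real h ^ 3"
    proof (intro always_eventually allI divide_right_mono)
      show "T h \<le> L * real h ^ 3 + K * (real h)\<^sup>2 + real C * (2 * real h + 1)\<^sup>2" for h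
        using K[of h] TS[of h] by linarith
    qed simp
  qed
  moreover have "(\<lambda>h. 2 / 3 * ((2 * real h + 1)\<^sup>2 / (real h)\<^sup>2)) \<longlonglongrightarrow> 8 / 3"
    by real_asymp
  ultimately have lim: "(\<lambda>h. 2 / 3 * ((2 * real h + 1)\<^sup>2 / (real h)\<^sup>2) / (T h / real h ^ 3)) \<longlonglongrightarrow> 8 / 3 / L"
    using L by (intro tendsto_divide) auto
  \<comment> \<open>The powers of \<open>h\<close> are cancelled for \<open>h > 0\<close>, which
    holds eventually.\<close>
  have "\<forall>\<^sub>F h in sequentially. 2 / 3 * ((2 * real h + 1)\<^sup>2 / (real h)\<^sup>2) / (T h / real h ^ 3) =
      velocity_seq (knight a b) h"
    using eventually_gt_at_top[of 0]
  proof eventually_elim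
    case (elim h)
    then have "(2 * real h + 1)\<^sup>2 / (real h)\<^sup>2 / (T h / real h ^ 3) = real h * (2 * real h + 1)\<^sup>2 / T h"
      by (simp add: power2_eq_square power3_eq_cube)
    then have "2 / 3 * ((2 * real h + 1)\<^sup>2 / (real h)\<^sup>2) / (T h / real h ^ 3) =
        2 / 3 * (real h * (2 * real h + 1)\<^sup>2 / T h)"
      by (simp only: times_divide_eq_right[symmetric])
    then show ?case
      unfolding velocity_seq_def T_def[symmetric] card_max_norm_ball
      by (simp add: inverse_eq_divide add.commute)
  qed
  from Lim_transform_eventually[OF lim this]
  have "velocity_seq (knight a b) \<longlonglongrightarrow> 8 / 3 / L" .
  moreover have "8 / 3 / L = 2 * (A + B) * B\<^sup>2 / (A\<^sup>2 + 3 * B\<^sup>2)"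
    using AB pos by (simp add: L_def field_simps)
  ultimately show ?thesis by (simp add: A_def B_def)
qed

end

theorem theorem1p2:
  shows "(\<forall>a b :: int. 1 \<le> a \<and> a < b \<and> gcd a b = 1 \<and> odd (a + b) \<longrightarrow>
            convergent (velocity_seq (knight a b)) \<and>
            average_velocity (knight a b) =
              2 * (real_of_int a + real_of_int b) * (real_of_int b)\<^sup>2 /
                ((real_of_int a)\<^sup>2 + 3 * (real_of_int b)\<^sup>2)) \<and>
         average_velocity (knight 1 2) = 24 / 13"
proof -
  have lim: "velocity_seq (knight a b) \<longlonglongrightarrow>
     2 * (real_of_int a + real_of_int b) * (real_of_int b)\<^sup>2 /
       ((real_of_int a)\<^sup>2 + 3 * (real_of_int b)\<^sup>2)"
    if "1 \<le> a \<and> a < b \<and> gcd a b = 1 \<and> odd (a + b)" for a b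
    using that by (intro knight_parameters.velocity_seq_tendsto knight_parameters.intro) auto
  have "average_velocity (knight 1 2) = 24 / 13"
    using limI[OF lim[of 1 2]] by (simp add: average_velocity_def)
  moreover have "convergent (velocity_seq (knight a b)) \<and> average_velocity (knight a b) =
      2 * (real_of_int a + real_of_int b) * (real_of_int b)\<^sup>2 /
        ((real_of_int a)\<^sup>2 + 3 * (real_of_int b)\<^sup>2)"
    if "1 \<le> a \<and> a < b \<and> gcd a b = 1 \<and> odd (a + b)" for a b
    using convergentI[OF lim[OF that]] limI[OF lim[OF that]] by (simp only: average_velocity_def)
  ultimately show ?thesis by blast
qed

end
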